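(* Let $n \ge 1$ be an integer, $\varphi > 0$ a real number with $n\varphi \le \pi$, and let $A, B \in \mathbb{R}^3$ with $A \ne B$. Let $B^{(0)}, B^{(1)}, \dots, B^{(n+1)} \in \mathbb{R}^3$ be points with $B^{(0)} = A$, $B^{(n+1)} = B$ (the successive vertices of the polygonal chain $\bigcup_{i=0}^{n} [B^{(i)}, B^{(i+1)}]$) such that $B^{(i)} \neq B^{(i-1)}$ for $i = 1, \dots, n+1$ and $$\angle\left(B^{(i+1)} - B^{(i)},\, B^{(i)} - B^{(i-1)}\right) \in [0, \varphi], \quad i = 1, \dots, n.$$ Then: 1. If $n \ge 2$, then $B^{(1)}, \dots, B^{(n)} \in \mathbf{S}(A, B, n\varphi)$, and $B^{(i)} \ne B^{(j)}$ for any distinct $i, j \in \{0, 1, \dots, n+1\}$. 2. If $n = 1$, then $B^{(1)} \in \operatorname{cl}\mathbf{S}(A, B, \varphi) \setminus \{A, B\}$.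
   Context: Angles: for nonzero $X, Y \in \mathbb{R}^3$, $\angle(X, Y) = \arccos\frac{(X, Y)}{|X||Y|} \in [0, \pi]$, where $(X,Y)$ is the Euclidean inner product; by convention $\angle(X, \mathbf{0}) = \angle(\mathbf{0}, X) = 0$ for every $X \in \mathbb{R}^3$. For $P, Q \in \mathbb{R}^3$, $P \ne Q$, and $\psi \in (0, \pi]$, define $$\mathbf{S}(P, Q, \psi) = \{C \in \mathbb{R}^3 \setminus \{P, Q\} \mid \angle(Q - C, C - P) \in [0, \psi)\},$$ $$\operatorname{cl}\mathbf{S}(P, Q, \psi) = \{C \in \mathbb{R}^3 \mid \angle(Q - C, C - P) \in [0, \psi]\}.$$ *)

theory Defs
  imports "HOL-Analysis.Analysis"
begin

(* The first branch is a genuine convention: the formula alone would give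
   arccos 0 = pi/2 when X or Y is zero, because x / 0 = 0. *)
definition angle :: "real ^ 3 \<Rightarrow> real ^ 3 \<Rightarrow> real" where
  "angle X Y = (if X = 0 \<or> Y = 0 then 0 else arccos ((X \<bullet> Y) / (norm X * norm Y)))"

definition spindle :: "real ^ 3 \<Rightarrow> real ^ 3 \<Rightarrow> real \<Rightarrow> (real ^ 3) set" where
  "spindle P Q \<psi> = {C \<in> UNIV - {P, Q}. angle (Q - C) (C - P) \<in> {0..<\<psi>}}"

(* Contains P and Q, by the zero convention for angle. *)
definition cl_spindle :: "real ^ 3 \<Rightarrow> real ^ 3 \<Rightarrow> real \<Rightarrow> (real ^ 3) set" where
  "cl_spindle P Q \<psi> = {C. angle (Q - C) (C - P) \<in> {0..\<psi>}}"

end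

(* Write e i = V (i + 1) - V i.  The angle obeys the spherical triangle inequality
   (through a nonzero vector), and adding e to w strictly decreases a nondegenerate
   angle with e.  Comparing a partial sum of edges with its extreme edge and then
   passing to the next edge therefore costs at most \<phi> per vertex, and strictly less
   than that from the second vertex on.  Splitting
   the angle at V i through the edge e i gives less than i \<phi> + (n - i) \<phi> = n \<phi>.
   A coincidence V i = V j would force an angle pi at V (j - 1) in the chain from
   V i to V j, against these bounds. *)

theory Submission imports Defs begin

lemma angle_commute: "angle X Y = angle Y X"
  by (simp add: angle_def inner_commute mult.commute)

lemma cos_arg_bounds:
  fixes X Y :: "'a :: real_inner"
  shows "- 1 \<le> (X \<bullet> Y) / (norm X * norm Y)" "(X \<bullet> Y) / (norm X * norm Y) \<le> 1"
proof -
  have "\<bar>(X \<bullet> Y) / (norm X * norm Y)\<bar> \<le> 1"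
    using Cauchy_Schwarz_ineq2[of X Y] by (auto simp: abs_mult divide_le_eq_1 zero_less_mult_iff)
  then show "- 1 \<le> (X \<bullet> Y) / (norm X * norm Y)" "(X \<bullet> Y) / (norm X * norm Y) \<le> 1"
    by linarith+
qed

lemma angle_nonneg: "0 \<le> angle X Y"
  using cos_arg_bounds[of X Y] by (auto simp: angle_def intro: arccos_lbound)

lemma angle_le_pi: "angle X Y \<le> pi"
  using cos_arg_bounds[of X Y] by (auto simp: angle_def intro: arccos_ubound)

lemma cos_angle:
  assumes "X \<noteq> 0" "Y \<noteq> 0"
  shows "cos (angle X Y) = (X \<bullet> Y) / (norm X * norm Y)"
  using cos_arg_bounds[of X Y] assms by (simp add: angle_def cos_arccos)

lemma angle_minus_self:
  assumes "X \<noteq> 0"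
  shows "angle (- X) X = pi"
  using assms by (simp add: angle_def power2_norm_eq_inner[symmetric] power2_eq_square)

text \<open>Cauchy-Schwarz for \<open>u\<close> and \<open>v\<close>, the components of
  \<open>x\<close> and \<open>z\<close> orthogonal to \<open>y\<close>. If \<open>x\<close>,
  \<open>y\<close> and \<open>y\<close>, \<open>z\<close> enclose the angles a and b, the left-hand
  side is cos (a + b).\<close>

lemma inner_unit_lower_bound:
  fixes x y z :: "'a :: real_inner"
  assumes "norm x = 1" "norm y = 1" "norm z = 1"
  shows "(x \<bullet> y) * (y \<bullet> z) - sqrt (1 - (x \<bullet> y)\<^sup>2) * sqrt (1 - (y \<bullet> z)\<^sup>2) \<le> x \<bullet> z"
proof -
  define u where "u = x - (x \<bullet> y) *\<^sub>R y"
  define v where "v = z - (y \<bullet> z) *\<^sub>R y"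
  have one: "x \<bullet> x = 1" "y \<bullet> y = 1" "z \<bullet> z = 1"
    using assms by (simp_all add: norm_eq_1)
  have "norm u = sqrt (1 - (x \<bullet> y)\<^sup>2)"
    unfolding norm_eq_sqrt_inner u_def
    by (simp add: inner_diff_left inner_diff_right one inner_commute power2_eq_square)
  moreover have "norm v = sqrt (1 - (y \<bullet> z)\<^sup>2)"
    unfolding norm_eq_sqrt_inner v_def
    by (simp add: inner_diff_left inner_diff_right one inner_commute power2_eq_square)
  moreover have "u \<bullet> v = x \<bullet> z - (x \<bullet> y) * (y \<bullet> z)"
    by (simp add: u_def v_def inner_diff_left inner_diff_right one inner_commute)
  moreover have "- (norm u * norm v) \<le> u \<bullet> v"
    using Cauchy_Schwarz_ineq2[of u v] by linarith
  ultimately show ?thesis by simp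
qed

(* A zero vector Y would make the right-hand side 0 by the convention for angle. *)
lemma angle_triangle:
  assumes Y: "Y \<noteq> 0"
  shows "angle X Z \<le> angle X Y + angle Y Z"
\<comment> \<open>Below pi the sum of the two angles lies in the range where the cosine is
  decreasing, so cosines can be compared; from pi on the bound is trivial.\<close>
proof (cases "X = 0 \<or> Z = 0 \<or> pi \<le> angle X Y + angle Y Z")
  case True
  then show ?thesis
    using angle_nonneg[of X Y] angle_nonneg[of Y Z] angle_le_pi[of X Z]
    by (auto simp: angle_def)
next
  case False
  then have X: "X \<noteq> 0" and Z: "Z \<noteq> 0" and less: "angle X Y + angle Y Z < pi" by auto
  have inner_sgn: "sgn P \<bullet> sgn Q = cos (angle P Q)" if "P \<noteq> 0" "Q \<noteq> 0" for P Q :: "real ^ 3"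
    using that by (simp add: cos_angle sgn_div_norm field_simps)
  have sin: "sqrt (1 - (cos (angle P Q))\<^sup>2) = sin (angle P Q)" for P Q
    using sin_ge_zero[OF angle_nonneg angle_le_pi, of P Q]
    by (simp add: sin_squared_eq[symmetric])
  have "cos (angle X Y + angle Y Z) \<le> cos (angle X Z)"
    using inner_unit_lower_bound[of "sgn X" "sgn Y" "sgn Z"] X Y Z
    by (simp add: norm_sgn inner_sgn sin cos_add)
  then show ?thesis
    using less angle_nonneg[of X Y] angle_nonneg[of Y Z] angle_nonneg[of X Z] angle_le_pi[of X Z]
    by (subst (asm) cos_mono_le_eq) auto
qed

text \<open>Comparison of the cosines of the angles from \<open>e\<close> to \<open>w\<close> and to
  \<open>e + w\<close>, with denominators cleared. Strictness is that of Cauchy-Schwarz.\<close>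

lemma inner_mult_norm_add_le:
  fixes e w :: "'a :: real_inner"
  shows "(e \<bullet> w) * norm (e + w) \<le> norm w * (e \<bullet> (e + w))"
    and "e \<noteq> 0 \<Longrightarrow> \<bar>e \<bullet> w\<bar> < norm e * norm w \<Longrightarrow>
      (e \<bullet> w) * norm (e + w) < norm w * (e \<bullet> (e + w))"
proof -
  \<comment> \<open>The sign of \<open>e \<bullet> w\<close> decides whether
    \<open>norm (e + w)\<close> must be bounded from above or from below.\<close>
  have upper: "(e \<bullet> w) * norm (e + w) \<le> (e \<bullet> w) * norm w + \<bar>e \<bullet> w\<bar> * norm e"
  proof (cases "0 \<le> e \<bullet> w")
    case True
    then have "(e \<bullet> w) * norm (e + w) \<le> (e \<bullet> w) * (norm e + norm w)"
      by (intro mult_left_mono norm_triangle_ineq)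
    with True show ?thesis by (simp add: algebra_simps)
  next
    case False
    have "norm w - norm e \<le> norm (e + w)"
      using norm_triangle_ineq4[of "e + w" e] by simp
    then have "(e \<bullet> w) * norm (e + w) \<le> (e \<bullet> w) * (norm w - norm e)"
      using False by (intro mult_left_mono_neg) auto
    with False show ?thesis by (simp add: algebra_simps)
  qed
  have expand: "norm w * (e \<bullet> (e + w)) = (e \<bullet> w) * norm w + norm e * norm w * norm e"
    by (simp add: inner_add_right power2_norm_eq_inner[symmetric] power2_eq_square algebra_simps)
  have "\<bar>e \<bullet> w\<bar> * norm e \<le> norm e * norm w * norm e"
    by (intro mult_right_mono Cauchy_Schwarz_ineq2) simp
  with upper expand show "(e \<bullet> w) * norm (e + w) \<le> norm w * (e \<bullet> (e + w))"
    by linarith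
  show "(e \<bullet> w) * norm (e + w) < norm w * (e \<bullet> (e + w))"
    if "e \<noteq> 0" "\<bar>e \<bullet> w\<bar> < norm e * norm w"
  proof -
    have "\<bar>e \<bullet> w\<bar> * norm e < norm e * norm w * norm e"
      using that by (intro mult_strict_right_mono) auto
    with upper expand show ?thesis by linarith
  qed
qed

text \<open>An angle pi can persist under adding \<open>e\<close>, as for \<open>w = -2 e\<close>;
  \<theta> < pi rules this out. An angle 0 cannot shrink; there strictness comes from 0 <
  \<theta>.\<close>

lemma angle_add_less:
  assumes e: "e \<noteq> 0" and w: "angle e w \<le> \<theta>" and \<theta>: "0 < \<theta>" "\<theta> < pi"
  shows "angle e (e + w) < \<theta>"
proof (cases "w = 0 \<or> e + w = 0")
  case True
  moreover have "angle e e = 0"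
    using e by (simp add: angle_def power2_norm_eq_inner[symmetric] power2_eq_square)
  ultimately show ?thesis using \<theta> by (auto simp: angle_def)
next
  case False
  then have w0: "w \<noteq> 0" and s0: "e + w \<noteq> 0" by auto
  \<comment> \<open>Both cosines are put over one denominator, so that the numerators are the two
    sides of \<open>inner_mult_norm_add_le\<close>.\<close>
  have sum: "cos (angle e (e + w)) = norm w * (e \<bullet> (e + w)) / (norm e * norm (e + w) * norm w)"
    using e w0 s0 by (simp add: cos_angle)
  have old: "cos (angle e w) = (e \<bullet> w) * norm (e + w) / (norm e * norm (e + w) * norm w)"
    using e w0 s0 by (simp add: cos_angle)
  have pos: "0 < norm e * norm (e + w) * norm w"
    using e w0 s0 by simp
  show ?thesis
  proof (cases "angle e w = 0")
    case True
    then have "cos 0 \<le> cos (angle e (e + w))"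
      using sum old inner_mult_norm_add_le(1)[of e w] pos by (metis divide_right_mono less_imp_le)
    then have "angle e (e + w) \<le> 0"
      by (subst (asm) cos_mono_le_eq) (auto simp: angle_nonneg angle_le_pi)
    then show ?thesis using \<theta> by simp
  next
    case False
    then have "0 < angle e w" "angle e w < pi"
      using angle_nonneg[of e w] w \<theta> by linarith+
    then have "cos pi < cos (angle e w)" "cos (angle e w) < cos 0"
      by (intro cos_monotone_0_pi; simp)+
    then have "\<bar>e \<bullet> w\<bar> < norm e * norm w"
      using e w0 by (simp add: cos_angle abs_less_iff field_simps)
    then have "cos (angle e w) < cos (angle e (e + w))"
      using inner_mult_norm_add_le(2)[of e w] e pos unfolding sum old
      by (intro divide_strict_right_mono)
    then have "angle e (e + w) < angle e w"
      by (subst (asm) cos_mono_less_eq) (auto simp: angle_nonneg angle_le_pi)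
    then show ?thesis using w by simp
  qed
qed

text \<open>Bends are indexed by the vertex before the corner, which avoids the truncated
  subtraction \<open>i - 1\<close>.\<close>

locale bounded_angle_chain =
  fixes n :: nat and \<phi> :: real and V :: "nat \<Rightarrow> real ^ 3"
  assumes \<phi>_pos: "0 < \<phi>"
    and total: "real n * \<phi> \<le> pi"
    and step: "i \<le> n \<Longrightarrow> V (Suc i) \<noteq> V i"
    and bend: "i < n \<Longrightarrow> angle (V (Suc (Suc i)) - V (Suc i)) (V (Suc i) - V i) \<le> \<phi>"
begin

text \<open>Supplies the bound \<theta> < pi of \<open>angle_add_less\<close> at every intermediate
  stage, even when n \<phi> = pi.\<close>

lemma less_pi: "k < n \<Longrightarrow> real k * \<phi> < pi"
  using \<phi>_pos total by (meson less_le_trans mult_strict_right_mono of_nat_less_iff)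

text \<open>The chain grows at its end. A single bend may equal \<phi>, so strictness starts at k =
  2, after one use of \<open>angle_add_less\<close>.\<close>

lemma angle_last_edge:
  assumes "k \<ge> 1" "a + k \<le> n"
  shows "angle (V (Suc (a + k)) - V (a + k)) (V (a + k) - V a) \<le> real k * \<phi> \<and>
    (k \<ge> 2 \<longrightarrow> angle (V (Suc (a + k)) - V (a + k)) (V (a + k) - V a) < real k * \<phi>)"
  using assms
proof (induction k rule: nat_induct_at_least)
  case base
  then show ?case using bend[of a] by simp
next
  case (Suc k)
  let ?e = "V (Suc (a + k)) - V (a + k)"
  let ?f = "V (Suc (Suc (a + k))) - V (Suc (a + k))"
  have e: "?e \<noteq> 0" using Suc step[of "a + k"] by simp
  have "angle ?e (?e + (V (a + k) - V a)) < real k * \<phi>"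
    using Suc e \<phi>_pos less_pi[of k] by (intro angle_add_less) auto
  moreover have "?e + (V (a + k) - V a) = V (Suc (a + k)) - V a" by simp
  moreover have "angle ?f ?e \<le> \<phi>" using Suc bend[of "a + k"] by simp
  ultimately have "angle ?f (V (Suc (a + k)) - V a) < real (Suc k) * \<phi>"
    using angle_triangle[OF e, of ?f "V (Suc (a + k)) - V a"] by (simp add: algebra_simps)
  then show ?case by simp
qed

text \<open>Mirror image of \<open>angle_last_edge\<close>: edges are added at the front, so the
  induction must let \<open>a\<close> vary.\<close>

lemma angle_first_edge:
  assumes "k \<ge> 1" "a + k \<le> n"
  shows "angle (V (Suc (a + k)) - V (Suc a)) (V (Suc a) - V a) \<le> real k * \<phi>"
  using assms
proof (induction k arbitrary: a rule: nat_induct_at_least)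
  case base
  then show ?case using bend[of a] by simp
next
  case (Suc k)
  let ?e = "V (Suc (Suc a)) - V (Suc a)"
  let ?w = "V (Suc (Suc a + k)) - V (Suc (Suc a))"
  have e: "?e \<noteq> 0" using Suc step[of "Suc a"] by simp
  have "angle ?w ?e \<le> real k * \<phi>" using Suc.IH[of "Suc a"] Suc.prems by simp
  then have "angle ?e (?e + ?w) < real k * \<phi>"
    using Suc e \<phi>_pos less_pi[of k]
    by (intro angle_add_less) (auto simp: angle_commute)
  moreover have "?e + ?w = V (Suc (a + Suc k)) - V (Suc a)" by simp
  moreover have "angle ?e (V (Suc a) - V a) \<le> \<phi>" using Suc bend[of a] by simp
  ultimately show ?case
    using angle_triangle[OF e, of "V (Suc (a + Suc k)) - V (Suc a)" "V (Suc a) - V a"]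
    by (simp add: algebra_simps angle_commute)
qed

lemma angle_at_vertex_less:
  assumes "n \<ge> 2" "1 \<le> i" "i \<le> n"
  shows "angle (V (Suc n) - V i) (V i - V 0) < real n * \<phi>"
\<comment> \<open>For i = n the bound (n - i) \<phi> is 0 and \<open>angle_add_less\<close> does not
  apply. Here the remaining vector is a single edge, and strictness comes from
  \<open>angle_last_edge\<close> with n \<ge> 2.\<close>
proof (cases "i = n")
  case True
  then show ?thesis using angle_last_edge[of n 0] assms by simp
next
  case False
  let ?e = "V (Suc i) - V i"
  let ?w = "V (Suc n) - V (Suc i)"
  have e: "?e \<noteq> 0" using assms step[of i] by simp
  have "angle ?w ?e \<le> real (n - i) * \<phi>"
    using angle_first_edge[of "n - i" i] assms False by simp
  then have "angle ?e (?e + ?w) < real (n - i) * \<phi>"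
    using assms False e \<phi>_pos less_pi[of "n - i"]
    by (intro angle_add_less) (auto simp: angle_commute)
  moreover have "?e + ?w = V (Suc n) - V i" by simp
  moreover have "angle ?e (V i - V 0) \<le> real i * \<phi>"
    using angle_last_edge[of i 0] assms by simp
  ultimately show ?thesis
    using angle_triangle[OF e, of "V (Suc n) - V i" "V i - V 0"] assms
    by (simp add: algebra_simps angle_commute of_nat_diff)
qed

lemma vertices_distinct:
  assumes "n \<ge> 2" "i < j" "j \<le> Suc n"
  shows "V i \<noteq> V j"
proof
  assume eq: "V i = V j"
  obtain k where j: "j = Suc (i + k)" using assms(2) less_iff_Suc_add by auto
  have step': "V (Suc (i + k)) \<noteq> V (i + k)" using step[of "i + k"] assms j by simp
  with eq j have k: "k \<ge> 1" by (cases k) auto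
  \<comment> \<open>The last edge leads back to \<open>V i\<close>, hence is opposite to
    \<open>V (i + k) - V i\<close>.\<close>
  have "angle (V (Suc (i + k)) - V (i + k)) (V (i + k) - V i) = pi"
    using angle_minus_self[of "V (i + k) - V i"] eq j step' by simp
  moreover have "k \<le> n" using assms j by simp
  then have "real k * \<phi> \<le> pi"
    using total \<phi>_pos by (meson less_imp_le mult_right_mono of_nat_le_iff order_trans)
  \<comment> \<open>This settles k = 1, where only a weak bound is available, and uses n \<ge> 2.
    For k \<ge> 2 the strict bound gives pi < k \<phi> \<le> pi.\<close>
  moreover have "\<phi> < pi" using less_pi[of 1] assms by simp
  ultimately show False
    using angle_last_edge[of k i] k assms j by (cases "k = 1") auto
qed

end

theorem theorem1:
  fixes n :: nat and \<phi> :: real and A B :: "real ^ 3" and V :: "nat \<Rightarrow> real ^ 3"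
  assumes "n \<ge> 1"
    and "\<phi> > 0"
    and "real n * \<phi> \<le> pi"
    and "A \<noteq> B"
    and "V 0 = A"
    and "V (n + 1) = B"
    and "\<And>i. i \<in> {1..n + 1} \<Longrightarrow> V i \<noteq> V (i - 1)"
    and "\<And>i. i \<in> {1..n} \<Longrightarrow> angle (V (i + 1) - V i) (V i - V (i - 1)) \<in> {0..\<phi>}"
  shows "(n \<ge> 2 \<longrightarrow>
           (\<forall>i \<in> {1..n}. V i \<in> spindle A B (real n * \<phi>)) \<and>
           (\<forall>i \<in> {0..n + 1}. \<forall>j \<in> {0..n + 1}. i \<noteq> j \<longrightarrow> V i \<noteq> V j)) \<and>
         (n = 1 \<longrightarrow> V 1 \<in> cl_spindle A B \<phi> - {A, B})"
proof -
  interpret bounded_angle_chain n \<phi> V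
  proof
    show "V (Suc i) \<noteq> V i" if "i \<le> n" for i
      using assms(7)[of "Suc i"] that by simp
    show "angle (V (Suc (Suc i)) - V (Suc i)) (V (Suc i) - V i) \<le> \<phi>" if "i < n" for i
      using assms(8)[of "Suc i"] that by simp
  qed (use assms in auto)
  have "V i \<in> spindle A B (real n * \<phi>)" if "n \<ge> 2" "i \<in> {1..n}" for i
    using angle_at_vertex_less[of i] vertices_distinct[of 0 i] vertices_distinct[of i "Suc n"]
      that assms(5,6) by (auto simp: spindle_def angle_nonneg)
  moreover have "V i \<noteq> V j" if "n \<ge> 2" "i \<in> {0..n + 1}" "j \<in> {0..n + 1}" "i \<noteq> j" for i j
    using vertices_distinct[of i j] vertices_distinct[of j i] that by (cases i j rule: linorder_cases) auto
  \<comment> \<open>With one interior vertex both difference vectors are edges, so the bend itself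
    is the required angle; it may equal \<phi>, hence the closed set.\<close>
  moreover have "V 1 \<in> cl_spindle A B \<phi> - {A, B}" if "n = 1"
    using step[of 0] step[of 1] bend[of 0] that assms(5,6)
    by (auto simp: cl_spindle_def angle_nonneg numeral_2_eq_2)
  ultimately show ?thesis by blast
qed

end
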